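(* For all $j$ such that $d_j<m$ (and all $k<j$), the variance of $\tilde a_{j,h_j(k)}$ is $$O\left(\frac{s}{(e^{\varepsilon_1}-1)^2}+\frac{s^2}{n^2\varepsilon_0^2}\right).$$
   Context: $G=(V,E)$ is a fixed simple graph on users $v_1,\dots,v_n$, with $a_{j,k}=1$ if $\{v_j,v_k\}\in E$ and $a_{j,k}=0$ otherwise, and $d_j=|\{k<j:a_{j,k}=1\}|$ (the "low degree" of $v_j$). Parameters: privacy budgets $\varepsilon_0,\varepsilon_1>0$, a positive integer $s$ (the sampling size), $p$ the smallest prime larger than $n$, $m=\lceil p/s\rceil$, and $\varepsilon'=\ln(1+s(e^{\varepsilon_1}-1))$. For each user $v_j$, a pair $(\theta_j,\phi_j)$ is drawn at random from $\{1,\dots,p-1\}\times\{0,\dots,p-1\}$, and $h_j(k)=((\theta_j k+\phi_j)\bmod p)\bmod m$. User $v_j$ partitions the users into the $m$ groups $S_{j,t}=\{v_k:h_j(k)=t\}$, padded with dummy elements (not adjacent to $v_j$) so that every group has size $s$, and draws from each group $S_{j,t}$ one representative $v_{c_t}$, each member being chosen with probability $1/s$. The bit of the group is $a_{j,c_t}$, replaced by $0$ if $c_t>j$ (and equal to $0$ for a dummy). For $k<j$, $a_{j,h_j(k)}$ denotes the bit of the group containing $v_k$. The bit $a'_{j,h_j(k)}$ is obtained from $a_{j,h_j(k)}$ by randomized response: it equals $a_{j,h_j(k)}$ with probability $\frac{e^{\varepsilon'}}{1+e^{\varepsilon'}}$ and its complement with probability $\frac1{1+e^{\varepsilon'}}$.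 Independently, $\tilde d_j=d_j+L_j$, where $L_j$ is Laplace noise of scale $1/\varepsilon_0$. Finally $$\omega_j=\frac{e^{\varepsilon'}+1}{e^{\varepsilon'}-1}\cdot\frac{ms-1}{m-1},\quad \tilde\sigma_j=\frac{s-1}{ms-s}\tilde d_j+\frac1{e^{\varepsilon'}-1}\cdot\frac{ms-1}{m-1},\quad \tilde a_{j,h_j(k)}=\omega_j a'_{j,h_j(k)}-\tilde\sigma_j .$$
   Formalization: The O-constant is taken uniform for ε₁ in any bounded range (ε₁ ≤ B, constant depending on B only), because with a constant uniform over all ε₁ > 0 the bound fails as ε₁ and ε₀ tend to infinity. *)

theory Defs
  imports "HOL-Probability.Probability" "HOL-Computational_Algebra.Primes"
begin

(* The users v_1, ..., v_n are the natural numbers 1, ..., n. *)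

definition simple_graph :: "nat \<Rightarrow> nat set set \<Rightarrow> bool" where
  "simple_graph n E \<longleftrightarrow> (\<forall>e\<in>E. e \<subseteq> {1..n} \<and> card e = 2)"

definition adjacent :: "nat set set \<Rightarrow> nat \<Rightarrow> nat \<Rightarrow> bool" where
  "adjacent E j k \<longleftrightarrow> {j, k} \<in> E"

definition low_degree :: "nat set set \<Rightarrow> nat \<Rightarrow> nat" where
  "low_degree E j = card {k. k < j \<and> adjacent E j k}"

definition next_prime :: "nat \<Rightarrow> nat" where
  "next_prime n = (LEAST p. prime p \<and> n < p)"

definition num_groups :: "nat \<Rightarrow> nat \<Rightarrow> nat" where
  "num_groups n s = nat \<lceil>real (next_prime n) / real s\<rceil>"

definition rr_budget :: "nat \<Rightarrow> real \<Rightarrow> real" where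
  "rr_budget s \<epsilon>1 = ln (1 + real s * (exp \<epsilon>1 - 1))"

definition hash_params :: "nat \<Rightarrow> (nat \<times> nat) pmf" where
  "hash_params n = pmf_of_set ({1..next_prime n - 1} \<times> {0..next_prime n - 1})"

definition hash :: "nat \<Rightarrow> nat \<Rightarrow> nat \<times> nat \<Rightarrow> nat \<Rightarrow> nat" where
  "hash n s = (\<lambda>(\<theta>, \<phi>) k. ((\<theta> * k + \<phi>) mod next_prime n) mod num_groups n s)"

definition group_users :: "nat \<Rightarrow> nat \<Rightarrow> nat \<times> nat \<Rightarrow> nat \<Rightarrow> nat set" where
  "group_users n s \<theta>\<phi> t = {k \<in> {1..n}. hash n s \<theta>\<phi> k = t}"

(* Inl k is the user v_k and Inr i is the i-th dummy.  A group never has more than s users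
   (it corresponds to residues mod p that agree mod m, and p <= m * s), so the truncated
   subtraction is exact and the padded group has size s. *)
definition padded_group :: "nat \<Rightarrow> nat \<Rightarrow> nat \<times> nat \<Rightarrow> nat \<Rightarrow> (nat + nat) set" where
  "padded_group n s \<theta>\<phi> t =
     group_users n s \<theta>\<phi> t <+> {..<s - card (group_users n s \<theta>\<phi> t)}"

definition representatives :: "nat \<Rightarrow> nat \<Rightarrow> nat \<times> nat \<Rightarrow> (nat \<Rightarrow> nat + nat) pmf" where
  "representatives n s \<theta>\<phi> =
     Pi_pmf {..<num_groups n s} (Inr 0) (\<lambda>t. pmf_of_set (padded_group n s \<theta>\<phi> t))"

definition rep_bit :: "nat set set \<Rightarrow> nat \<Rightarrow> nat + nat \<Rightarrow> bool" where
  "rep_bit E j c = (case c of Inl k \<Rightarrow> k \<le> j \<and> adjacent E j k | Inr _ \<Rightarrow> False)"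

definition randomized_response :: "real \<Rightarrow> bool \<Rightarrow> bool pmf" where
  "randomized_response \<epsilon> b =
     map_pmf (\<lambda>keep. if keep then b else \<not> b) (bernoulli_pmf (exp \<epsilon> / (1 + exp \<epsilon>)))"

(* Joint law of the hash parameters of v_j and the perturbed bits, indexed by the group t < m. *)
definition noisy_bits ::
    "nat \<Rightarrow> nat set set \<Rightarrow> nat \<Rightarrow> real \<Rightarrow> nat \<Rightarrow> ((nat \<times> nat) \<times> (nat \<Rightarrow> bool)) pmf" where
  "noisy_bits n E s \<epsilon>1 j =
     bind_pmf (hash_params n) (\<lambda>\<theta>\<phi>.
     bind_pmf (representatives n s \<theta>\<phi>) (\<lambda>c.
     bind_pmf (Pi_pmf {..<num_groups n s} False
                 (\<lambda>t. randomized_response (rr_budget s \<epsilon>1) (rep_bit E j (c t)))) (\<lambda>a'.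
     return_pmf (\<theta>\<phi>, a'))))"

definition laplace_density :: "real \<Rightarrow> real \<Rightarrow> real" where
  "laplace_density b x = exp (- \<bar>x\<bar> / b) / (2 * b)"

definition laplace :: "real \<Rightarrow> real measure" where
  "laplace b = density lborel (\<lambda>x. ennreal (laplace_density b x))"

(* All randomness used by v_j; the product measure makes the degree noise independent. *)
definition user_space ::
    "nat \<Rightarrow> nat set set \<Rightarrow> nat \<Rightarrow> real \<Rightarrow> real \<Rightarrow> nat \<Rightarrow>
      (((nat \<times> nat) \<times> (nat \<Rightarrow> bool)) \<times> real) measure" where
  "user_space n E s \<epsilon>0 \<epsilon>1 j = measure_pmf (noisy_bits n E s \<epsilon>1 j) \<Otimes>\<^sub>M laplace (1 / \<epsilon>0)"

(* For m = 1 the next two quantities divide by zero on paper; here they are then constantly 0. *)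
definition omega :: "nat \<Rightarrow> nat \<Rightarrow> real \<Rightarrow> real" where
  "omega n s \<epsilon>1 =
     (let m = real (num_groups n s); e = exp (rr_budget s \<epsilon>1)
      in (e + 1) / (e - 1) * ((m * real s - 1) / (m - 1)))"

definition sigma_noisy :: "nat \<Rightarrow> nat \<Rightarrow> real \<Rightarrow> real \<Rightarrow> real" where
  "sigma_noisy n s \<epsilon>1 d =
     (let m = real (num_groups n s); e = exp (rr_budget s \<epsilon>1)
      in (real s - 1) / (m * real s - real s) * d
           + 1 / (e - 1) * ((m * real s - 1) / (m - 1)))"

definition a_tilde ::
    "nat \<Rightarrow> nat set set \<Rightarrow> nat \<Rightarrow> real \<Rightarrow> nat \<Rightarrow> nat \<Rightarrow>
      ((nat \<times> nat) \<times> (nat \<Rightarrow> bool)) \<times> real \<Rightarrow> real" where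
  "a_tilde n E s \<epsilon>1 j k = (\<lambda>((\<theta>\<phi>, a'), L).
     omega n s \<epsilon>1 * of_bool (a' (hash n s \<theta>\<phi> k))
       - sigma_noisy n s \<epsilon>1 (real (low_degree E j) + L))"

end

(* The variance is at most the second moment about any constant.  Centring at minus the value of
   sigma_noisy without noise leaves omega * bit - A * L with A of order s/n, so the claim reduces
   to the second moment 2/eps0^2 of L and to P(bit = 1) <= 5/s + 1/(1 + exp eps').  With
   x = exp eps1 - 1 one has exp eps' = 1 + s x and omega <= 2 (s x + 2)/x, and s x + 2 = O(s)
   because eps1 <= B.

   The bound on P(bit = 1): each of the low neighbours of j represents the group of k with
   probability at most 1/s if it collides with k.  For distinct users k, l the pair of values
   (theta k + phi, theta l + phi) mod p is an injective function of (theta, phi), so at most p s of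
   the p (p - 1) parameters give a collision; there are fewer than m <= 2p/s low neighbours.

   If m = 1, omega and A vanish because x/0 = 0. *)

theory Submission imports Defs
begin

section \<open>Variance against second moments, and the even moments of the Laplace law\<close>

section \<open>Moments\<close>

text \<open>A shift by \<open>c\<close> leaves the variance unchanged, and E(X - c)^2 exceeds it by
  (E(X) - c)^2. Integrability of \<open>X\<close> comes from that of the square, the total mass
  being finite.\<close>

lemma (in prob_space) variance_le_second_moment:
  fixes X :: "'a \<Rightarrow> real"
  assumes [measurable]: "X \<in> borel_measurable M"
    and int: "integrable M (\<lambda>x. (X x - c)\<^sup>2)"
  shows "variance X \<le> expectation (\<lambda>x. (X x - c)\<^sup>2)"
proof -
  have I: "integrable M (\<lambda>x. X x - c)"
    using int by (rule square_integrable_imp_integrable[rotated]) simp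
  then have IX: "integrable M X"
    using Bochner_Integration.integrable_add[OF I, of "\<lambda>_. c"] by simp
  have "variance X = variance (\<lambda>x. X x - c)"
    using IX by (simp add: prob_space)
  also have "\<dots> = expectation (\<lambda>x. (X x - c)\<^sup>2) - (expectation (\<lambda>x. X x - c))\<^sup>2"
    using I int by (rule variance_eq)
  finally show ?thesis by simp
qed

text \<open>Carries an integral computed under a marginal law back to the product space;
  \<open>g\<close> will be a projection.\<close>

lemma has_bochner_integral_distrD:
  fixes f :: "'a \<Rightarrow> 'b::{banach, second_countable_topology}"
  assumes "has_bochner_integral (distr M N g) f x" "g \<in> measurable M N" "f \<in> borel_measurable N"
  shows "has_bochner_integral M (\<lambda>x. f (g x)) x"
  using assms by (simp add: has_bochner_integral_iff integrable_distr_eq integral_distr)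

text \<open>Swapping the factors turns the second projection into the first, whose law is
  \<open>distr_pair_fst\<close>.\<close>

lemma distr_pair_snd:
  assumes "prob_space M" "prob_space N"
  shows "distr (M \<Otimes>\<^sub>M N) N snd = N"
proof -
  interpret M: prob_space M by fact
  interpret N: prob_space N by fact
  interpret pair_sigma_finite N M ..
  have "distr (M \<Otimes>\<^sub>M N) N snd = distr (distr (N \<Otimes>\<^sub>M M) (M \<Otimes>\<^sub>M N) (\<lambda>(x, y). (y, x))) N snd"
    using pair_sigma_finite.distr_pair_swap[of M N] by (simp add: pair_sigma_finite_def
      M.sigma_finite_measure_axioms N.sigma_finite_measure_axioms)
  also have "\<dots> = distr (N \<Otimes>\<^sub>M M) N fst"
    by (subst distr_distr) (auto intro!: distr_cong)
  finally show ?thesis by (simp add: M.distr_pair_fst)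
qed

text \<open>Away from the origin the Laplace density is the mean of an exponential density and its
  mirror image, and an even power does not see the reflection. The case \<open>i = 0\<close> gives
  total mass 1, the case \<open>i = 2\<close> the second moment.\<close>

lemma laplace_even_moment:
  assumes b: "b > 0" and i: "even i"
  shows "(\<integral>\<^sup>+ x. ennreal (x ^ i) \<partial>laplace b) = fact i * b ^ i"
proof -
  let ?E = "erlang_density 0 (1 / b)"
  have [measurable]: "laplace_density b \<in> borel_measurable borel"
    unfolding laplace_density_def[abs_def] by measurable
  \<comment> \<open>At 0 both exponential densities are positive, so their mean is twice the Laplace
    density there; this single point is a null set.\<close>
  have dens: "laplace_density b x = (?E x + ?E (- x)) / 2" if "x \<noteq> 0" for x
    using that b by (auto simp: laplace_density_def erlang_density_def field_simps)
  have ae: "AE x in lborel. x \<noteq> (0::real)"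
    by (rule AE_lborel_singleton)
  have nn: "?E x \<ge> 0" for x
    using b by simp
  have *: "(\<integral>\<^sup>+ x. ennreal (?E x * x ^ i) \<partial>lborel) = fact i * b ^ i"
    using nn_integral_erlang_ith_moment[of "1 / b" 0 i] b by (simp add: power_divide)
  have **: "(\<integral>\<^sup>+ x. ennreal (?E (- x) * x ^ i) \<partial>lborel) = fact i * b ^ i"
    using nn_integral_real_affine[of "\<lambda>x. ennreal (?E x * x ^ i)" "-1" 0] * i by simp
  have "(\<integral>\<^sup>+ x. ennreal (x ^ i) \<partial>laplace b)
      = (\<integral>\<^sup>+ x. ennreal (laplace_density b x) * ennreal (x ^ i) \<partial>lborel)"
    unfolding laplace_def by (subst nn_integral_density) auto
  also have "\<dots> = (\<integral>\<^sup>+ x. ennreal (1/2) * (ennreal (?E x * x ^ i) + ennreal (?E (- x) * x ^ i)) \<partial>lborel)"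
    using ae
  proof (intro nn_integral_cong_AE, eventually_elim)
    case (elim x)
    have "x ^ i \<ge> 0" using i by (rule zero_le_even_power)
    then show ?case
      using nn[of x] nn[of "- x"]
      by (simp add: dens[OF elim(2)] distrib_right add_divide_distrib del: ennreal_half
          flip: ennreal_mult ennreal_plus)
  qed
  also have "\<dots> = ennreal (1/2) * (ennreal (fact i * b ^ i) + ennreal (fact i * b ^ i))"
    by (subst nn_integral_cmult; (subst nn_integral_add)?) (auto simp: * **)
  also have "\<dots> = fact i * b ^ i"
    using b by (simp del: ennreal_half flip: ennreal_mult ennreal_plus)
  finally show ?thesis .
qed

lemma prob_space_laplace:
  assumes "b > 0"
  shows "prob_space (laplace b)"
proof
  show "emeasure (laplace b) (space (laplace b)) = 1"
    using laplace_even_moment[OF assms, of 0] by simp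
qed

lemma sets_laplace [measurable_cong, simp]: "sets (laplace b) = sets borel"
  by (simp add: laplace_def)

lemma space_laplace [simp]: "space (laplace b) = UNIV"
  by (simp add: laplace_def)

lemma laplace_second_moment:
  assumes "b > 0"
  shows "has_bochner_integral (laplace b) (\<lambda>x. x\<^sup>2) (2 * b\<^sup>2)"
  using laplace_even_moment[OF assms, of 2] by (intro has_bochner_integral_nn_integral) auto

section \<open>Size of m relative to p / s\<close>

section \<open>Number of groups\<close>

lemma prime_next_prime: "prime (next_prime n)" and next_prime_gt: "n < next_prime n"
proof -
  have "prime (next_prime n) \<and> n < next_prime n"
    unfolding next_prime_def by (rule LeastI_ex) (use bigger_prime[of n] in auto)
  then show "prime (next_prime n)" "n < next_prime n" by auto
qed

text \<open>The ceiling means p/s \<le> m < p/s + 1. The first bound limits residue classes mod m to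
  s elements below p; the second yields m s \<le> 2 p once m > 1.\<close>

lemma num_groups_bounds:
  assumes "s > 0"
  shows "next_prime n \<le> num_groups n s * s" "num_groups n s * s < next_prime n + s"
proof -
  let ?c = "\<lceil>real (next_prime n) / real s\<rceil>"
  have "real (num_groups n s) = of_int ?c"
    unfolding num_groups_def by simp
  then have "real (next_prime n) / s \<le> real (num_groups n s)"
    "real (num_groups n s) < real (next_prime n) / s + 1"
    by linarith+
  then have "real (next_prime n) \<le> real (num_groups n s * s)"
    "real (num_groups n s * s) < real (next_prime n + s)"
    using assms by (auto simp: field_simps)
  then show "next_prime n \<le> num_groups n s * s" "num_groups n s * s < next_prime n + s"
    by linarith+
qed

lemma num_groups_pos: "s > 0 \<Longrightarrow> num_groups n s > 0"
  using num_groups_bounds(1)[of s n] next_prime_gt[of n] by (cases "num_groups n s") auto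

section \<open>Counting the hash parameters under which two users share a group\<close>

section \<open>Hash collisions\<close>

text \<open>Within a residue class a number is determined by its quotient by \<open>m\<close>, and
  for numbers below \<open>p\<close> this quotient is less than \<open>s\<close>.\<close>

lemma card_residue_class_le:
  fixes m :: nat
  assumes "p \<le> m * s"
  shows "card {r. r < p \<and> r mod m = t} \<le> s"
proof -
  have "inj_on (\<lambda>r. r div m) {r. r < p \<and> r mod m = t}"
  proof (rule inj_onI, unfold mem_Collect_eq)
    fix x y :: nat
    assume "x < p \<and> x mod m = t" "y < p \<and> y mod m = t" "x div m = y div m"
    then show "x = y"
      using div_mult_mod_eq[of x m] div_mult_mod_eq[of y m] by simp
  qed
  moreover have "(\<lambda>r. r div m) ` {r. r < p \<and> r mod m = t} \<subseteq> {..<s}"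
    using assms by (auto simp: less_mult_imp_div_less mult.commute)
  ultimately show ?thesis
    using card_inj_on_le[of "\<lambda>r. r div m" _ "{..<s}"] by simp
qed

text \<open>Subtracting the two congruences gives p | (a - c)(k - l). As k and l are distinct
  residues, p divides a - c, so a = c, and then b = d. Divisibility is handled in \<open>int\<close>
  because differences may be negative.\<close>

lemma affine_map_mod_prime_inj:
  fixes p k l :: nat
  assumes p: "prime p" and kl: "k < p" "l < p" "k \<noteq> l"
  shows "inj_on (\<lambda>(\<theta>, \<phi>). ((\<theta> * k + \<phi>) mod p, (\<theta> * l + \<phi>) mod p)) ({..<p} \<times> {..<p})"
proof -
  have small: "x = y" if "int p dvd int x - int y" "x < p" "y < p" for x y
  proof -
    have "int x mod int p = int y mod int p"
      using that(1) by (simp only: mod_eq_dvd_iff)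
    then show ?thesis using that(2,3) by simp
  qed
  have main: "a = c \<and> b = d"
    if lt: "a < p" "b < p" "c < p" "d < p"
      and eq: "(a * k + b) mod p = (c * k + d) mod p" "(a * l + b) mod p = (c * l + d) mod p"
    for a b c d
  proof -
    have dvd: "int p dvd (int a * h + b) - (int c * h + d)"
      if "(a * h + b) mod p = (c * h + d) mod p" for h
    proof -
      have "int (a * h + b) mod int p = int (c * h + d) mod int p"
        using that by (simp only: zmod_int[symmetric])
      then show ?thesis by (simp add: mod_eq_dvd_iff)
    qed
    have "int p dvd (int a - int c) * (int k - int l)"
      using dvd_diff[OF dvd[OF eq(1)] dvd[OF eq(2)]] by (simp add: algebra_simps)
    then have "int p dvd int a - int c \<or> int p dvd int k - int l"
      using p by (simp add: prime_dvd_mult_iff)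
    then have ac: "a = c"
      using small[of a c] small[of k l] kl lt by blast
    then have "int p dvd int b - int d"
      using dvd[OF eq(1)] by simp
    with ac show ?thesis
      using small[of b d] lt by simp
  qed
  show ?thesis
  proof (rule inj_onI, unfold split_paired_all mem_Times_iff fst_conv snd_conv prod.case prod.inject lessThan_iff)
    fix a b c d
    assume "a < p \<and> b < p" "c < p \<and> d < p"
      "(a * k + b) mod p = (c * k + d) mod p \<and> (a * l + b) mod p = (c * l + d) mod p"
    then show "a = c \<and> b = d" by (intro main) blast+
  qed
qed

text \<open>A colliding parameter is encoded injectively by the pair (r, r') of affine values mod p,
  which agree mod m. There are p choices of r and at most s of r' for each.\<close>

lemma card_hash_collision_le:
  assumes s: "s > 0" and kl: "k \<le> n" "l \<le> n" "k \<noteq> l"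
  shows "card {x \<in> {1..next_prime n - 1} \<times> {0..next_prime n - 1}. hash n s x k = hash n s x l}
           \<le> next_prime n * s"
proof -
  let ?p = "next_prime n" and ?m = "num_groups n s"
  let ?H = "{x \<in> {1..?p - 1} \<times> {0..?p - 1}. hash n s x k = hash n s x l}"
  let ?f = "\<lambda>(\<theta>, \<phi>). ((\<theta> * k + \<phi>) mod ?p, (\<theta> * l + \<phi>) mod ?p)"
  let ?R = "SIGMA r : {..<?p}. {r'. r' < ?p \<and> r' mod ?m = r mod ?m}"
  have p: "?p > 0" using next_prime_gt[of n] by simp
  have "inj_on ?f ?H"
    by (rule inj_on_subset[OF affine_map_mod_prime_inj[OF prime_next_prime]])
      (use kl next_prime_gt[of n] p in auto)
  moreover have "?f ` ?H \<subseteq> ?R"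
    using p by (auto simp: hash_def)
  moreover have "finite ?R" by auto
  ultimately have "card ?H \<le> card ?R" by (rule card_inj_on_le)
  also have "\<dots> = (\<Sum>r<?p. card {r'. r' < ?p \<and> r' mod ?m = r mod ?m})"
    by (rule card_SigmaI) auto
  also have "\<dots> \<le> (\<Sum>r<?p. s)"
    by (intro sum_mono card_residue_class_le num_groups_bounds s)
  finally show ?thesis by simp
qed

section \<open>Bounding the probability that the perturbed bit of the group of k is one\<close>

section \<open>Probability of a reported one\<close>

text \<open>Truncated subtraction gives c + (s - c) \<ge> s for every c. The lower bound on the size
  is what makes each member's probability at most 1/s.\<close>

lemma padded_group:
  assumes "s > 0"
  shows "finite (padded_group n s x t)" "s \<le> card (padded_group n s x t)"
    "padded_group n s x t \<noteq> {}"
proof -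
  have fin: "finite (group_users n s x t)"
    by (simp add: group_users_def)
  then show "finite (padded_group n s x t)"
    by (simp add: padded_group_def)
  show le: "s \<le> card (padded_group n s x t)"
    using fin by (simp add: padded_group_def card_Plus)
  show "padded_group n s x t \<noteq> {}"
    using le assms by force
qed

text \<open>A one is reported only if the bit is one or the bit is flipped. For a true bit the bound
  already exceeds 1.\<close>

lemma pmf_randomized_response_True:
  "pmf (randomized_response e b) True \<le> of_bool b + 1 / (1 + exp e)"
proof (cases b)
  case True
  then show ?thesis
    by (simp add: pmf_le_1 add_nonneg_nonneg order_trans[OF pmf_le_1])
next
  case False
  have e1: "1 + exp e > 0" by (simp add: add_pos_pos)
  then have e: "0 \<le> exp e / (1 + exp e)" "exp e / (1 + exp e) \<le> 1"
    by (auto simp: field_simps)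
  have "randomized_response e b = map_pmf Not (bernoulli_pmf (exp e / (1 + exp e)))"
    using False by (simp add: randomized_response_def if_distrib cong: if_cong)
  \<comment> \<open>\<open>True\<close> is written as \<open>Not False\<close> so that the rule for
    images under an injection applies to \<open>Not\<close>.\<close>
  then have "pmf (randomized_response e b) True
      = pmf (map_pmf Not (bernoulli_pmf (exp e / (1 + exp e)))) (Not False)"
    by simp
  also have "\<dots> = 1 - exp e / (1 + exp e)"
    using e by (subst pmf_map_inj') (auto simp: inj_on_def)
  also have "\<dots> = 1 / (1 + exp e)"
    using e1 by (simp add: divide_simps)
  finally show ?thesis by simp
qed

text \<open>The unperturbed bit is one only if the representative is a low neighbour of j lying in
  group t, and each such user is drawn with probability at most 1/s. Flipping adds the last
  term.\<close>

lemma representative_bit_le: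
  assumes s: "s > 0" and G: "simple_graph n E" and j: "j \<in> {1..n}"
  shows "pmf (bind_pmf (pmf_of_set (padded_group n s x t))
           (\<lambda>c. randomized_response e (rep_bit E j c))) True
       \<le> (\<Sum>l | l < j \<and> adjacent E j l. of_bool (hash n s x l = t)) / real s + 1 / (1 + exp e)"
proof -
  let ?P = "padded_group n s x t" and ?N = "{l. l < j \<and> adjacent E j l}"
  note P = padded_group[OF s, of n x t]
  have cP: "real (card ?P) > 0"
    using P(2) s by linarith
  \<comment> \<open>\<open>rep_bit\<close> admits k \<le> j while low neighbours satisfy l < j; the
    gap k = j closes because an edge has two distinct endpoints.\<close>
  have irr: "\<not> adjacent E j j"
    using G by (force simp: simple_graph_def adjacent_def)
  have "{c \<in> ?P. rep_bit E j c} \<subseteq> Inl ` {l \<in> ?N. hash n s x l = t}"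
    using irr by (auto simp: padded_group_def group_users_def rep_bit_def le_less)
  then have "card {c \<in> ?P. rep_bit E j c} \<le> card (Inl ` {l \<in> ?N. hash n s x l = t} :: (nat + nat) set)"
    by (intro card_mono) auto
  also have "\<dots> \<le> card {l \<in> ?N. hash n s x l = t}"
    by (intro card_image_le) auto
  finally have card: "card {c \<in> ?P. rep_bit E j c} \<le> card {l \<in> ?N. hash n s x l = t}" .
  have eq: "(\<Sum>l\<in>?N. of_bool (hash n s x l = t)) = real (card {l \<in> ?N. hash n s x l = t})"
    by (simp add: Int_def)
  have "pmf (bind_pmf (pmf_of_set ?P) (\<lambda>c. randomized_response e (rep_bit E j c))) True
      = (\<Sum>c\<in>?P. pmf (randomized_response e (rep_bit E j c)) True) / card ?P"
    using P by (subst pmf_bind_pmf_of_set) auto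
  also have "\<dots> \<le> (\<Sum>c\<in>?P. of_bool (rep_bit E j c) + 1 / (1 + exp e)) / card ?P"
    by (intro divide_right_mono sum_mono pmf_randomized_response_True) auto
  also have "\<dots> = card {c \<in> ?P. rep_bit E j c} / card ?P + 1 / (1 + exp e)"
    using cP P(1,3) by (simp add: sum.distrib add_divide_distrib Int_def)
  also have "\<dots> \<le> card {l \<in> ?N. hash n s x l = t} / s + 1 / (1 + exp e)"
    using card P(2) s by (intro add_right_mono frac_le) auto
  finally show ?thesis unfolding eq .
qed

text \<open>Reading one coordinate of a product law leaves the factor at that coordinate, first for
  the perturbed bits, then for the representatives. What remains is one draw from the group of k and
  one randomized response.\<close>

lemma map_noisy_bits:
  assumes "s > 0"
  shows "map_pmf (\<lambda>(x, a). a (hash n s x k)) (noisy_bits n E s e1 j) =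
    bind_pmf (hash_params n) (\<lambda>x. bind_pmf (pmf_of_set (padded_group n s x (hash n s x k)))
      (\<lambda>c. randomized_response (rr_budget s e1) (rep_bit E j c)))"
proof -
  \<comment> \<open>The index must lie in range, since outside it \<open>Pi_pmf\<close> returns its
    default value.\<close>
  have lt: "hash n s x k < num_groups n s" for x
    using num_groups_pos[OF assms, of n] by (auto simp: hash_def split: prod.splits)
  have "map_pmf (\<lambda>(x, a). a (hash n s x k)) (noisy_bits n E s e1 j) =
    bind_pmf (hash_params n) (\<lambda>x. bind_pmf (representatives n s x) (\<lambda>c.
      map_pmf (\<lambda>a. a (hash n s x k)) (Pi_pmf {..<num_groups n s} False
                 (\<lambda>t. randomized_response (rr_budget s e1) (rep_bit E j (c t))))))"
    by (simp add: noisy_bits_def map_bind_pmf map_pmf_def bind_assoc_pmf bind_return_pmf)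
  also have "\<dots> = bind_pmf (hash_params n) (\<lambda>x. bind_pmf (representatives n s x) (\<lambda>c.
      randomized_response (rr_budget s e1) (rep_bit E j (c (hash n s x k)))))"
    using lt by (simp add: Pi_pmf_component)
  also have "\<dots> = bind_pmf (hash_params n) (\<lambda>x. bind_pmf
      (map_pmf (\<lambda>c. c (hash n s x k)) (representatives n s x)) (\<lambda>c.
      randomized_response (rr_budget s e1) (rep_bit E j c)))"
    by (simp add: bind_map_pmf)
  finally show ?thesis
    using lt by (simp add: representatives_def Pi_pmf_component)
qed

text \<open>Averages the bound for fixed hash parameters. Of the constant 5, one unit is for k
  itself, which may be a low neighbour of j, and four are for collisions of the other low neighbours
  with k.\<close>

lemma noisy_bit_prob_le:
  assumes s: "s > 0" and G: "simple_graph n E" and j: "j \<in> {1..n}" and k: "k \<in> {1..n}"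
    and d: "low_degree E j \<le> num_groups n s" and m: "num_groups n s > 1"
  shows "measure_pmf.expectation (noisy_bits n E s e1 j) (\<lambda>(x, a). of_bool (a (hash n s x k)))
         \<le> 5 / real s + 1 / (1 + exp (rr_budget s e1))"
proof -
  let ?p = "next_prime n" and ?m = "num_groups n s" and ?N = "{l. l < j \<and> adjacent E j l}"
  let ?S = "{1..?p - 1} \<times> {0..?p - 1}"
  let ?D = "noisy_bits n E s e1 j" and ?r = "1 / (1 + exp (rr_budget s e1))"
  have p: "?p \<ge> 2" using prime_next_prime[of n] by (rule prime_ge_2_nat)
  have S: "?S \<noteq> {}" "finite ?S" using p by auto
  have cS: "card ?S = (?p - 1) * ?p" using p by simp
  have fN: "finite ?N" by simp
  \<comment> \<open>For \<open>l = k\<close> every parameter collides, so the full size of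
    \<open>?S\<close> has to be allowed in that case.\<close>
  have coll: "(\<Sum>x\<in>?S. of_bool (hash n s x l = hash n s x k))
      \<le> real (?p * s) + of_bool (l = k) * real ((?p - 1) * ?p)" if "l \<in> ?N" for l
  proof (cases "l = k")
    case True
    then show ?thesis using cS by (simp add: algebra_simps)
  next
    case False
    have "card {x \<in> ?S. hash n s x l = hash n s x k} \<le> ?p * s"
      using False that j k by (intro card_hash_collision_le s) auto
    then have "real (card {x \<in> ?S. hash n s x l = hash n s x k}) \<le> real (?p * s)"
      by (rule of_nat_mono)
    moreover have "(\<Sum>x\<in>?S. of_bool (hash n s x l = hash n s x k))
        = real (card {x \<in> ?S. hash n s x l = hash n s x k})"
      using S(2) by (simp add: Int_def)
    ultimately show ?thesis using False by simp
  qed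
  have "(\<Sum>x\<in>?S. \<Sum>l\<in>?N. of_bool (hash n s x l = hash n s x k))
      = (\<Sum>l\<in>?N. \<Sum>x\<in>?S. of_bool (hash n s x l = hash n s x k) :: real)"
    by (rule sum.swap)
  also have "\<dots> \<le> (\<Sum>l\<in>?N. real (?p * s) + of_bool (l = k) * real ((?p - 1) * ?p))"
    by (intro sum_mono coll)
  also have "\<dots> = real (card ?N) * (?p * s) + (\<Sum>l\<in>?N. of_bool (l = k)) * real ((?p - 1) * ?p)"
    by (simp add: sum.distrib sum_distrib_right)
  also have "(\<Sum>l\<in>?N. of_bool (l = k)) \<le> (1::real)"
    using fN by (simp add: Int_def card_le_Suc0_iff_eq)
  finally have sum: "(\<Sum>x\<in>?S. \<Sum>l\<in>?N. of_bool (hash n s x l = hash n s x k))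
      \<le> real (card ?N) * (?p * s) + real ((?p - 1) * ?p)"
    by (simp add: mult_right_mono)
  \<comment> \<open>With m > 1, the bounds 2 s \<le> m s and m s < p + s give m s \<le> 2 p, and 2 p
    \<le> 4 (p - 1) because p \<ge> 2. This is the source of the factor 4.\<close>
  have "2 * s \<le> ?m * s" using m by (intro mult_right_mono) auto
  then have "?m * s \<le> 2 * ?p"
    using num_groups_bounds(2)[OF s, of n] by linarith
  moreover have "card ?N * s \<le> ?m * s"
    using d by (intro mult_right_mono) (auto simp: low_degree_def)
  ultimately have "card ?N * s \<le> 4 * (?p - 1)" using p by linarith
  then have "real (card ?N * s) \<le> real (4 * (?p - 1))" by (rule of_nat_mono)
  then have Ns: "real (card ?N) * (real ?p * s) \<le> 4 * real ((?p - 1) * ?p)"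
    using mult_right_mono[of "real (card ?N * s)" "real (4 * (?p - 1))" "real ?p"]
    by (simp only: of_nat_mult of_nat_numeral mult_ac)
  have "measure_pmf.expectation ?D (\<lambda>(x, a). of_bool (a (hash n s x k)) :: real)
      = measure_pmf.expectation (map_pmf (\<lambda>(x, a). a (hash n s x k)) ?D) of_bool"
    by (simp add: case_prod_unfold integral_map_pmf)
  also have "\<dots> = pmf (map_pmf (\<lambda>(x, a). a (hash n s x k)) ?D) True"
    by (subst integral_measure_pmf[of UNIV]) (auto simp: UNIV_bool)
  also have "\<dots> = (\<Sum>x\<in>?S. pmf (bind_pmf (pmf_of_set (padded_group n s x (hash n s x k)))
      (\<lambda>c. randomized_response (rr_budget s e1) (rep_bit E j c))) True) / card ?S"
    unfolding map_noisy_bits[OF s] hash_params_def using S by (subst pmf_bind_pmf_of_set) auto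
  also have "\<dots> \<le> (\<Sum>x\<in>?S. (\<Sum>l\<in>?N. of_bool (hash n s x l = hash n s x k)) / s + ?r) / card ?S"
    by (intro divide_right_mono sum_mono representative_bit_le s G j) simp
  also have "\<dots> = (\<Sum>x\<in>?S. \<Sum>l\<in>?N. of_bool (hash n s x l = hash n s x k)) / s / card ?S + ?r"
    using S by (simp add: sum.distrib add_divide_distrib flip: sum_divide_distrib)
  also have "\<dots> \<le> (5 * card ?S) / s / card ?S + ?r"
    unfolding cS using sum Ns by (intro add_right_mono divide_right_mono) auto
  also have "\<dots> = 5 / s + ?r"
    using S by simp
  finally show ?thesis .
qed

section \<open>Splitting into bit and noise, size of the coefficients, and the final
  estimate\<close>

section \<open>The variance\<close>

text \<open>After centring at \<open>?c\<close> the variable is \<open>?w\<close> times the bit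
  minus \<open>?A\<close> times the noise. The inequality (x - y)^2 \<le> 2 x^2 + 2 y^2 removes the
  cross term, so only the two marginals enter: a bit equals its square and has mean
  \<open>q\<close>, and the noise has second moment 2/e0^2.\<close>

lemma variance_a_tilde_le:
  fixes n s j k :: nat and E :: "nat set set" and e0 e1 :: real
  assumes e0: "e0 > 0"
  defines "D \<equiv> noisy_bits n E s e1 j" and "m \<equiv> real (num_groups n s)"
  defines "q \<equiv> measure_pmf.expectation D (\<lambda>(x, a). of_bool (a (hash n s x k)))"
  shows "prob_space.variance (user_space n E s e0 e1 j) (a_tilde n E s e1 j k)
    \<le> 2 * (omega n s e1)\<^sup>2 * q + 4 * ((real s - 1) / (m * real s - real s))\<^sup>2 / e0\<^sup>2"
proof -
  let ?w = "omega n s e1" and ?A = "(real s - 1) / (m * real s - real s)"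
  let ?U = "user_space n E s e0 e1 j" and ?L = "laplace (1 / e0)"
  let ?b = "\<lambda>z::(nat \<times> nat) \<times> (nat \<Rightarrow> bool). of_bool (snd z (hash n s (fst z) k)) :: real"
  let ?c = "- sigma_noisy n s e1 (low_degree E j)"
  interpret L: prob_space ?L using e0 by (intro prob_space_laplace) simp
  have U: "?U = measure_pmf D \<Otimes>\<^sub>M ?L" by (simp add: user_space_def D_def)
  interpret U: prob_space ?U
    unfolding U by (rule prob_space_pair) (unfold_locales)
  have at: "a_tilde n E s e1 j k z - ?c = ?w * ?b (fst z) - ?A * snd z" for z
    by (cases z) (auto simp: a_tilde_def sigma_noisy_def m_def Let_def ring_distribs)
  have [measurable]: "?b \<in> borel_measurable (measure_pmf D)" by simp
  have mb [measurable]: "(\<lambda>z. ?b (fst z)) \<in> borel_measurable ?U" unfolding U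
    by (rule measurable_compose[OF measurable_fst]) simp
  have ms [measurable]: "snd \<in> borel_measurable ?U" unfolding U
    using measurable_snd[of "measure_pmf D" ?L] by (simp cong: measurable_cong_sets)
  have "(\<lambda>z. ?w * ?b (fst z) - ?A * snd z + ?c) \<in> borel_measurable ?U"
    by measurable
  then have m1: "a_tilde n E s e1 j k \<in> borel_measurable ?U"
    unfolding at[symmetric] by simp
  have d1: "distr ?U (measure_pmf D) fst = measure_pmf D"
    unfolding U by (rule L.distr_pair_fst)
  have d2: "distr ?U ?L snd = ?L"
    unfolding U by (intro distr_pair_snd) unfold_locales
  have "integrable (measure_pmf D) ?b"
    by (rule measure_pmf.integrable_const_bound[where B = 1]) auto
  then have "has_bochner_integral (measure_pmf D) ?b q"
    by (simp add: has_bochner_integral_iff q_def case_prod_unfold)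
  then have I1: "has_bochner_integral ?U (\<lambda>z. ?b (fst z)) q"
    using has_bochner_integral_distrD[of ?U "measure_pmf D" fst ?b q] unfolding d1 by (simp add: U)
  have "has_bochner_integral ?L (\<lambda>x. x\<^sup>2) (2 / e0\<^sup>2)"
    using laplace_second_moment[of "1 / e0"] e0 by (simp add: power_divide)
  then have I2: "has_bochner_integral ?U (\<lambda>z. (snd z)\<^sup>2) (2 / e0\<^sup>2)"
    using has_bochner_integral_distrD[of ?U ?L snd "\<lambda>x. x\<^sup>2" "2 / e0\<^sup>2"]
    unfolding d2 by (simp add: U)
  let ?B = "\<lambda>z. 2 * ?w\<^sup>2 * ?b (fst z) + 2 * ?A\<^sup>2 * (snd z)\<^sup>2"
  have I: "has_bochner_integral ?U ?B (2 * ?w\<^sup>2 * q + 2 * ?A\<^sup>2 * (2 / e0\<^sup>2))"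
    using I1 I2 by (intro has_bochner_integral_add has_bochner_integral_mult_right) auto
  have of_bool_square: "(of_bool P)\<^sup>2 = (of_bool P :: real)" for P
    by simp
  have le: "(a_tilde n E s e1 j k z - ?c)\<^sup>2 \<le> ?B z" for z
  proof -
    have "(x - y)\<^sup>2 \<le> 2 * x\<^sup>2 + 2 * y\<^sup>2" for x y :: real
      using zero_le_power2[of "x + y"] by (simp add: power2_eq_square algebra_simps)
    from this[of "?w * ?b (fst z)" "?A * snd z"] show ?thesis
      unfolding at power_mult_distrib of_bool_square mult.assoc .
  qed
  have int: "integrable ?U (\<lambda>z. (a_tilde n E s e1 j k z - ?c)\<^sup>2)"
  proof (rule Bochner_Integration.integrable_bound[OF I[THEN integrable.intros]])
    show "AE z in ?U. norm ((a_tilde n E s e1 j k z - ?c)\<^sup>2) \<le> norm (?B z)"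
      unfolding real_norm_def abs_power2 by (rule AE_I2) (rule order_trans[OF le abs_ge_self])
  qed (use m1 in measurable)
  have "U.variance (a_tilde n E s e1 j k) \<le> U.expectation (\<lambda>z. (a_tilde n E s e1 j k z - ?c)\<^sup>2)"
    by (rule U.variance_le_second_moment[OF m1 int])
  also have "\<dots> \<le> U.expectation ?B"
    by (rule integral_mono[OF int I[THEN integrable.intros] le])
  also have "\<dots> = 2 * ?w\<^sup>2 * q + 4 * ?A\<^sup>2 / e0\<^sup>2"
    using I by (simp add: has_bochner_integral_iff)
  finally show ?thesis .
qed

text \<open>Both bounds rest on 2 s \<le> m s: it gives (m s - 1)/(m - 1) \<le> 2 s for the factor
  in \<open>omega\<close>, and m s - s \<ge> m s / 2 \<ge> n/2 for the denominator of the noise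
  coefficient.\<close>

lemma coefficient_bounds:
  fixes n s :: nat and e1 :: real
  assumes n: "n > 0" and s: "s > 0" and m: "num_groups n s > 1" and e1: "e1 > 0"
  defines "x \<equiv> exp e1 - 1" and "m \<equiv> real (num_groups n s)"
  shows "\<bar>omega n s e1\<bar> \<le> 2 * (real s * x + 2) / x"
    and "\<bar>(real s - 1) / (m * real s - real s)\<bar> \<le> 2 * s / n"
proof -
  have x: "x > 0" using e1 by (simp add: x_def)
  have m2: "m \<ge> 2" using m by (simp add: m_def)
  have s1: "real s \<ge> 1" using s by simp
  have e: "exp (rr_budget s e1) = 1 + s * x"
    using x s by (simp add: rr_budget_def x_def add_pos_nonneg)
  have ge: "(m * s - 1) / (m - 1) \<ge> 0"
    using m2 s1 mult_mono[of 1 m 1 s] by simp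
  have "2 * real s \<le> m * s" using m2 by (intro mult_right_mono) auto
  then have le: "(m * s - 1) / (m - 1) \<le> 2 * s"
    using m2 by (simp add: field_simps)
  have om: "omega n s e1 = (s * x + 2) / (s * x) * ((m * s - 1) / (m - 1))"
    by (simp add: omega_def e m_def Let_def add.commute)
  have "0 \<le> omega n s e1"
    unfolding om using ge x by (intro mult_nonneg_nonneg) auto
  moreover have "omega n s e1 \<le> (s * x + 2) / (s * x) * (2 * s)"
    unfolding om using le x by (intro mult_left_mono) auto
  moreover have "(s * x + 2) / (s * x) * (2 * s) = 2 * (real s * x + 2) / x"
    using x s by simp
  ultimately show "\<bar>omega n s e1\<bar> \<le> 2 * (real s * x + 2) / x"
    by linarith
  show "\<bar>(real s - 1) / (m * real s - real s)\<bar> \<le> 2 * s / n"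
  proof -
    have "real n \<le> m * s"
      using num_groups_bounds(1)[OF s, of n] next_prime_gt[of n]
      unfolding m_def of_nat_mult[symmetric] of_nat_le_iff by linarith
    with \<open>2 * real s \<le> m * s\<close> have "real n / 2 \<le> m * s - s" by linarith
    then have "(real s - 1) / (m * real s - real s) \<le> s / (real n / 2)"
      using s1 n by (intro frac_le) auto
    moreover have "(real s - 1) / (m * real s - real s) \<ge> 0"
      using s1 m2 by (intro divide_nonneg_nonneg) auto
    ultimately show ?thesis by (simp add: mult.commute del: abs_divide)
  qed
qed

text \<open>The O-notation is read as a single constant, chosen after the cap \<open>B\<close> on
  \<epsilon>1 and before all other parameters.\<close>

theorem theorem4:
  fixes B :: real
  assumes "B > 0"
  shows "\<exists>C>0. \<forall>(n::nat) (E::nat set set) (s::nat) (\<epsilon>0::real) (\<epsilon>1::real) (j::nat) (k::nat).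
           simple_graph n E \<longrightarrow> s > 0 \<longrightarrow> \<epsilon>0 > 0 \<longrightarrow> \<epsilon>1 > 0 \<longrightarrow> \<epsilon>1 \<le> B \<longrightarrow>
           j \<in> {1..n} \<longrightarrow> low_degree E j < num_groups n s \<longrightarrow> k \<in> {1..n} \<longrightarrow> k < j \<longrightarrow>
           prob_space.variance (user_space n E s \<epsilon>0 \<epsilon>1 j) (a_tilde n E s \<epsilon>1 j k)
             \<le> C * (real s / (exp \<epsilon>1 - 1)\<^sup>2 + (real s)\<^sup>2 / ((real n)\<^sup>2 * \<epsilon>0\<^sup>2))"
proof -
  \<comment> \<open>\<open>K\<close> bounds x + 2 = exp \<epsilon>1 + 1. In \<open>C\<close>, the
    first summand pays for the bit and 16 = 4 * 2^2 for the degree noise.\<close>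
  define K where "K = exp B + 1"
  define C where "C = 8 * (5 * K\<^sup>2 + K) + 16"
  have K: "K > 0" by (simp add: K_def add_pos_pos)
  have C: "C \<ge> 8 * (5 * K\<^sup>2 + K)" "C \<ge> 16" "C > 0"
    using K by (auto simp: C_def intro: add_nonneg_pos)
  have "prob_space.variance (user_space n E s \<epsilon>0 \<epsilon>1 j) (a_tilde n E s \<epsilon>1 j k)
      \<le> C * (real s / (exp \<epsilon>1 - 1)\<^sup>2 + (real s)\<^sup>2 / ((real n)\<^sup>2 * \<epsilon>0\<^sup>2))" (is "?V \<le> ?R")
    if G: "simple_graph n E" and s: "s > 0" and e0: "\<epsilon>0 > 0" and e1: "\<epsilon>1 > 0" and eB: "\<epsilon>1 \<le> B"
      and j: "j \<in> {1..n}" and d: "low_degree E j < num_groups n s" and k: "k \<in> {1..n}"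
    for n E s \<epsilon>0 \<epsilon>1 j k
  proof -
    define q where "q = measure_pmf.expectation (noisy_bits n E s \<epsilon>1 j)
      (\<lambda>(x, a). of_bool (a (hash n s x k)) :: real)"
    let ?w = "omega n s \<epsilon>1" and ?A = "(real s - 1) / (real (num_groups n s) * real s - real s)"
    define x where "x = exp \<epsilon>1 - 1"
    \<comment> \<open>This is 1 + exp \<epsilon>', both the numerator in the bound on
      \<open>omega\<close> and the reciprocal of the flip probability.\<close>
    define y where "y = s * x + 2"
    have V: "?V \<le> 2 * (?w\<^sup>2 * q) + 4 * (?A\<^sup>2 / \<epsilon>0\<^sup>2)"
      using variance_a_tilde_le[OF e0, of n E s \<epsilon>1 j k] by (simp add: q_def)
    have x: "x > 0" using e1 by (simp add: x_def)
    have y: "y > 0" using x by (simp add: y_def add_nonneg_pos)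
    have R0: "real s / x\<^sup>2 \<ge> 0" "(real s)\<^sup>2 / ((real n)\<^sup>2 * \<epsilon>0\<^sup>2) \<ge> 0" by auto
    show ?thesis
    proof (cases "num_groups n s = 1")
      case True
      \<comment> \<open>Both denominators, m - 1 and m s - s, are zero here.\<close>
      then have "?w = 0" "?A = 0" by (auto simp: omega_def Let_def)
      with V have "?V \<le> 0" by simp
      also have "0 \<le> ?R" using C R0 by (simp add: x_def)
      finally show ?thesis .
    next
      case False
      then have m: "num_groups n s > 1"
        using num_groups_pos[OF s, of n] by linarith
      have n: "n > 0" using j by auto
      have "exp (rr_budget s \<epsilon>1) = y - 1"
        using x s by (simp add: rr_budget_def x_def y_def add_pos_nonneg)
      then have q: "q \<le> 5 / s + 1 / y"
        using noisy_bit_prob_le[OF s G j k _ m, of \<epsilon>1] d by (simp add: q_def)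
      have w: "?w\<^sup>2 \<le> (2 * y / x)\<^sup>2"
        using coefficient_bounds(1)[OF n s m e1] x y
        by (intro power2_le_iff_abs_le[THEN iffD2]) (auto simp: x_def y_def)
      have A: "?A\<^sup>2 \<le> (2 * s / n)\<^sup>2"
        using coefficient_bounds(2)[OF n s m e1]
        by (intro power2_le_iff_abs_le[THEN iffD2]) auto
      have "x + 2 \<le> K" using eB by (simp add: x_def K_def)
      then have "s * (x + 2) \<le> s * K" by (intro mult_left_mono) auto
      \<comment> \<open>Since s \<ge> 1, the summand 2 in \<open>y\<close> is at most 2 s.\<close>
      then have yK: "y \<le> s * K"
        using s by (simp add: y_def algebra_simps)
      \<comment> \<open>The square of \<open>y\<close> meets 5/s and 1/y; with \<open>y\<close> of
        order s both products are of order s, not s^2.\<close>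
      have y2: "y\<^sup>2 * (5 / s + 1 / y) = 5 * y\<^sup>2 / s + y"
        using y by (simp add: distrib_left power2_eq_square)
      have sK: "5 * (s * K)\<^sup>2 / s + s * K = (5 * K\<^sup>2 + K) * s"
        using s by (simp add: distrib_right power2_eq_square)
      have "?w\<^sup>2 * q \<le> ?w\<^sup>2 * (5 / s + 1 / y)"
        using q by (intro mult_left_mono) auto
      also have "\<dots> \<le> (2 * y / x)\<^sup>2 * (5 / s + 1 / y)"
        using w y by (intro mult_right_mono) auto
      also have "\<dots> = 4 / x\<^sup>2 * (5 * y\<^sup>2 / s + y)"
        unfolding y2[symmetric] by (simp add: power_divide power_mult_distrib)
      also have "\<dots> \<le> 4 / x\<^sup>2 * (5 * (s * K)\<^sup>2 / s + s * K)"
        using yK y by (intro mult_left_mono add_mono divide_right_mono power_mono) auto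
      also have "\<dots> = 4 * (5 * K\<^sup>2 + K) * (s / x\<^sup>2)"
        unfolding sK by simp
      finally have "2 * (?w\<^sup>2 * q) \<le> 8 * (5 * K\<^sup>2 + K) * (s / x\<^sup>2)" by argo
      also have "\<dots> \<le> C * (s / x\<^sup>2)"
        using C R0 by (intro mult_right_mono) auto
      finally have 1: "2 * (?w\<^sup>2 * q) \<le> C * (s / x\<^sup>2)" .
      have "4 * (?A\<^sup>2 / \<epsilon>0\<^sup>2) \<le> 4 * ((2 * s / n)\<^sup>2 / \<epsilon>0\<^sup>2)"
        using A by (intro mult_left_mono divide_right_mono) auto
      also have "\<dots> = 16 * ((real s)\<^sup>2 / ((real n)\<^sup>2 * \<epsilon>0\<^sup>2))"
        by (simp add: power_divide power_mult_distrib)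
      also have "\<dots> \<le> C * ((real s)\<^sup>2 / ((real n)\<^sup>2 * \<epsilon>0\<^sup>2))"
        using C R0 by (intro mult_right_mono) auto
      finally show ?thesis
        using V 1 by (simp add: x_def distrib_left)
    qed
  qed
  then show ?thesis using C(3) by blast
qed

end
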